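(* Let $k_1,k_2\ge 1$, let $A\in\mathbb{R}^{k_1\times k_2}$, and let $\eta_1,\eta_2>0$ be arbitrary step-sizes. Let $T:\mathbb{R}^{k_1}\times\mathbb{R}^{k_2}\to\mathbb{R}^{k_1}\times\mathbb{R}^{k_2}$ be the one-step map of alternating gradient descent, $$T(x_1,x_2)=\big(y_1,\;x_2-\eta_2A^\intercal y_1\big),\qquad y_1=x_1+\eta_1Ax_2 .$$ Then $T$ is volume preserving, for any measurable set of initial conditions: $T$ is a measurable function with $\ell(T^{-1}(U))=\ell(U)$ for every open set $U\subseteq\mathbb{R}^{k_1}\times\mathbb{R}^{k_2}$, and for every Lebesgue measurable set $S\subseteq\mathbb{R}^{k_1}\times\mathbb{R}^{k_2}$ of initial conditions, $T(S)$ is Lebesgue measurable and $\ell(T(S))=\ell(S)$.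
   Context: $\ell$ denotes Lebesgue measure on $\mathbb{R}^{k_1}\times\mathbb{R}^{k_2}\cong\mathbb{R}^{k_1+k_2}$ (values may be $+\infty$). A volume preserving transformation of $\mathbb{R}^d$ is a measurable function $T:\mathbb{R}^d\to\mathbb{R}^d$ such that $\ell(U)=\ell(T^{-1}(U))$ for every open set $U\subseteq\mathbb{R}^d$. *)

theory Defs
  imports "HOL-Analysis.Analysis"
begin

(* Measurability is Borel measurability. U is Borel, so emeasure lebesgue agrees with
   emeasure lborel on both sides; the values are in ennreal and may be infinite. *)
definition volume_preserving :: "('a::euclidean_space \<Rightarrow> 'a) \<Rightarrow> bool" where
  "volume_preserving T \<longleftrightarrow>
     T \<in> borel_measurable borel \<and>
     (\<forall>U. open U \<longrightarrow> emeasure lebesgue (T -` U) = emeasure lebesgue U)"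

(* A is a k1 by k2 matrix: its rows are indexed by 'k1 and its columns by 'k2. *)
definition alt_gd_step ::
  "real ^ 'k2 ^ 'k1 \<Rightarrow> real \<Rightarrow> real \<Rightarrow> (real ^ 'k1) \<times> (real ^ 'k2) \<Rightarrow> (real ^ 'k1) \<times> (real ^ 'k2)"
  where
  "alt_gd_step A \<eta>1 \<eta>2 = (\<lambda>(x1, x2).
     let y1 = x1 + \<eta>1 *\<^sub>R (A *v x2)
     in (y1, x2 - \<eta>2 *\<^sub>R (transpose A *v y1)))"

end

theory Submission
  imports Defs
begin

text \<open>
  The step map is the composition of two shears, \<open>(x1, x2) \<mapsto> (x1 + p x2, x2)\<close> followed by
  \<open>(x1, x2) \<mapsto> (x1, x2 + q x1)\<close>. By Fubini and the translation invariance of Lebesgue measure on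
  the slices, every measurable shear preserves Lebesgue measure. Shears are inverted by shears,
  so the image of a set is its preimage under another map of the same kind.
\<close>

lemma borel_measurable_swap:
  "(\<lambda>(x, y). (y, x)) \<in> borel \<rightarrow>\<^sub>M (borel :: ('b::euclidean_space \<times> 'a::euclidean_space) measure)"
  unfolding borel_prod[symmetric] by measurable

lemma measurable_shear [measurable]:
  fixes f :: "'a::euclidean_space \<Rightarrow> 'b::euclidean_space"
  assumes [measurable]: "f \<in> borel_measurable borel"
  shows measurable_shear_snd: "(\<lambda>(x, y). (x, y + f x)) \<in> borel \<rightarrow>\<^sub>M borel"
    and measurable_shear_fst: "(\<lambda>(y, x). (y + f x, x)) \<in> borel \<rightarrow>\<^sub>M borel"
  unfolding borel_prod[symmetric] by measurable

text \<open>Invariance is phrased as an equation between pushforwards because this form passes to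
  compositions. On the slice over \<open>x\<close> the shear is translation by the constant
  \<open>f x\<close>, so \<open>f\<close> may be any Borel function.\<close>

lemma distr_lborel_shear_snd:
  fixes f :: "'a::euclidean_space \<Rightarrow> 'b::euclidean_space"
  assumes [measurable]: "f \<in> borel_measurable borel"
  shows "distr lborel borel (\<lambda>(x, y). (x, y + f x)) = lborel"
proof (rule measure_eqI)
  fix U :: "('a \<times> 'b) set"
  assume "U \<in> sets (distr lborel borel (\<lambda>(x, y). (x, y + f x)))"
  then have U[measurable]: "U \<in> sets borel" by simp
  let ?h = "\<lambda>(x, y). (x, y + f x)"
  have h[measurable]: "?h \<in> borel \<rightarrow>\<^sub>M borel"
    by measurable
  have hU: "?h -` U \<in> sets (lborel \<Otimes>\<^sub>M lborel)"
    using measurable_sets[OF h U] by (simp only: lborel_prod space_borel Int_UNIV_right sets_lborel)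
  have "emeasure (distr lborel borel ?h) U = emeasure (lborel \<Otimes>\<^sub>M lborel) (?h -` U)"
    by (simp add: emeasure_distr lborel_prod)
  also have "\<dots> = (\<integral>\<^sup>+x. emeasure lborel (Pair x -` ?h -` U) \<partial>lborel)"
    by (rule lborel.emeasure_pair_measure_alt[OF hU])
  \<comment> \<open>The slice of the preimage at \<open>x\<close> is the slice of \<open>U\<close>
    translated by \<open>- f x\<close>, so the integrands agree pointwise.\<close>
  also have "\<dots> = (\<integral>\<^sup>+x. emeasure lborel (Pair x -` U) \<partial>lborel)"
  proof (rule nn_integral_cong)
    fix x :: 'a
    have U': "Pair x -` U \<in> sets borel"
      using U unfolding borel_prod[symmetric] by (rule sets_Pair1)
    have "emeasure lborel (Pair x -` U) = emeasure (distr lborel borel ((+) (f x))) (Pair x -` U)"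
      by (simp add: lborel_distr_plus)
    also have "\<dots> = emeasure lborel ((+) (f x) -` Pair x -` U)"
      using U' by (simp add: emeasure_distr)
    also have "(+) (f x) -` Pair x -` U = Pair x -` ?h -` U"
      by (auto simp: add.commute)
    finally show "emeasure lborel (Pair x -` ?h -` U) = emeasure lborel (Pair x -` U)" ..
  qed
  also have "\<dots> = emeasure (lborel \<Otimes>\<^sub>M lborel) U"
    by (rule lborel.emeasure_pair_measure_alt[symmetric]) (simp only: lborel_prod sets_lborel U)
  finally show "emeasure (distr lborel borel ?h) U = emeasure lborel U"
    by (simp add: lborel_prod)
qed simp

lemma distr_lborel_swap:
  "distr lborel borel (\<lambda>(x, y). (y, x)) = (lborel :: ('b::euclidean_space \<times> 'a::euclidean_space) measure)"
proof -
  have "lborel \<Otimes>\<^sub>M lborel =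
      distr (lborel \<Otimes>\<^sub>M lborel) (lborel \<Otimes>\<^sub>M lborel) (\<lambda>(x::'a, y::'b). (y, x))"
    by (rule pair_sigma_finite.distr_pair_swap) unfold_locales
  then show ?thesis
    by (simp only: lborel_prod) (simp cong: distr_cong)
qed

lemma distr_lborel_comp:
  assumes "g \<in> borel \<rightarrow>\<^sub>M borel" "h \<in> borel \<rightarrow>\<^sub>M borel"
    and "distr lborel borel g = lborel" "distr lborel borel h = lborel"
  shows "distr lborel borel (g \<circ> h) = lborel"
  using assms distr_distr[of g borel borel h lborel] by simp

text \<open>Conjugating by the coordinate swap reduces this to the shear of the second
  component.\<close>

lemma distr_lborel_shear_fst:
  fixes f :: "'a::euclidean_space \<Rightarrow> 'b::euclidean_space"
  assumes f: "f \<in> borel_measurable borel"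
  shows "distr lborel borel (\<lambda>(y, x). (y + f x, x)) = lborel"
proof -
  let ?h = "\<lambda>(x, y). (x, y + f x)"
  have "distr lborel borel ((\<lambda>(x, y). (y, x)) \<circ> (?h \<circ> (\<lambda>(y, x). (x, y)))) = lborel"
    by (intro distr_lborel_comp measurable_comp[of _ _ borel] borel_measurable_swap
        measurable_shear_snd distr_lborel_shear_snd distr_lborel_swap f)
  also have "(\<lambda>(x, y). (y, x)) \<circ> (?h \<circ> (\<lambda>(y, x). (x, y))) = (\<lambda>(y, x). (y + f x, x))"
    by auto
  finally show ?thesis .
qed

text \<open>A Borel map may pull a Lebesgue set back to a non-measurable one. Here the pushforward
  equation makes preimages of Borel null sets null, so \<open>g\<close> stays measurable between the
  completions.\<close>

lemma lebesgue_vimage_preserving: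
  fixes g :: "'a::euclidean_space \<Rightarrow> 'b::euclidean_space"
  assumes g: "g \<in> borel \<rightarrow>\<^sub>M borel" and distr: "distr lborel borel g = lborel"
    and S: "S \<in> sets lebesgue"
  shows "g -` S \<in> sets lebesgue" "emeasure lebesgue (g -` S) = emeasure lebesgue S"
proof -
  have g': "g \<in> lebesgue \<rightarrow>\<^sub>M lborel"
    using g by (simp add: measurable_completion)
  have *: "distr lebesgue lborel g = lborel"
    using g distr by (simp add: distr_completion cong: distr_cong)
  have m: "g \<in> lebesgue \<rightarrow>\<^sub>M lebesgue"
    by (rule completion.measurable_completion2[OF g']) (simp add: *)
  show "g -` S \<in> sets lebesgue"
    using measurable_sets[OF m S] by simp
  \<comment> \<open>Since \<open>g\<close> respects null sets, completing the pushforward is the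
    same as pushing forward into the completed space.\<close>
  have "lebesgue = distr lebesgue lebesgue g"
    using completion.completion_distr_eq[OF g'] * by simp
  then have "emeasure lebesgue S = emeasure (distr lebesgue lebesgue g) S"
    by simp
  then show "emeasure lebesgue (g -` S) = emeasure lebesgue S"
    by (simp only: emeasure_distr[OF m S]) simp
qed

theorem theorem11:
  fixes A :: "real ^ 'k2 ^ 'k1" and \<eta>1 \<eta>2 :: real
  assumes "\<eta>1 > 0" and "\<eta>2 > 0"
  shows "volume_preserving (alt_gd_step A \<eta>1 \<eta>2) \<and>
    (\<forall>S \<in> sets lebesgue.
       alt_gd_step A \<eta>1 \<eta>2 ` S \<in> sets lebesgue \<and>
       emeasure lebesgue (alt_gd_step A \<eta>1 \<eta>2 ` S) = emeasure lebesgue S)"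
proof -
  \<comment> \<open>The step size is a parameter of either sign: negating it inverts the
    corresponding shear.\<close>
  define p where "p c x = c *\<^sub>R (A *v x)" for c :: real and x
  define q where "q c x = c *\<^sub>R (transpose A *v x)" for c :: real and x
  have [measurable]: "p c \<in> borel_measurable borel" "q c \<in> borel_measurable borel" for c
    unfolding p_def q_def
    by (intro borel_measurable_continuous_onI continuous_intros
        linear_continuous_on_compose matrix_vector_mul_linear)+
  define P where "P c = (\<lambda>(y, x). (y + p c x, x))" for c
  define Q where "Q c = (\<lambda>(x, y). (x, y + q c x))" for c
  have meas: "P c \<in> borel \<rightarrow>\<^sub>M borel" "Q c \<in> borel \<rightarrow>\<^sub>M borel" for c
    unfolding P_def Q_def by measurable
  have distr: "distr lborel borel (P c) = lborel" "distr lborel borel (Q c) = lborel" for c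
    unfolding P_def Q_def by (simp_all add: distr_lborel_shear_fst distr_lborel_shear_snd)
  \<comment> \<open>The second update reads the already updated \<open>y1\<close>; this alternation
    is what yields a composition of shears.\<close>
  have T: "alt_gd_step A \<eta>1 \<eta>2 = Q (- \<eta>2) \<circ> P \<eta>1"
    by (auto simp: alt_gd_step_def P_def Q_def p_def q_def Let_def)
  let ?T' = "P (- \<eta>1) \<circ> Q \<eta>2"
  \<comment> \<open>\<open>?T'\<close> undoes the two shears in reverse order and is a two-sided
    inverse, which turns images into preimages.\<close>
  have image: "alt_gd_step A \<eta>1 \<eta>2 ` S = ?T' -` S" for S
  proof -
    have "?T' (alt_gd_step A \<eta>1 \<eta>2 z) = z" "alt_gd_step A \<eta>1 \<eta>2 (?T' z) = z" for z
      by (cases z; simp add: T P_def Q_def p_def q_def)+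
    then show ?thesis
      by (auto simp del: o_apply) (metis image_eqI)
  qed
  have T_borel: "alt_gd_step A \<eta>1 \<eta>2 \<in> borel \<rightarrow>\<^sub>M borel" "?T' \<in> borel \<rightarrow>\<^sub>M borel"
    unfolding T by (intro measurable_comp[of _ _ borel] meas)+
  have T_distr: "distr lborel borel (alt_gd_step A \<eta>1 \<eta>2) = lborel" "distr lborel borel ?T' = lborel"
    unfolding T by (intro distr_lborel_comp meas distr)+
  \<comment> \<open>The preimage lemma for the step map settles open sets; the same lemma for
    \<open>?T'\<close> settles images of Lebesgue sets.\<close>
  show ?thesis
    unfolding volume_preserving_def image
    using T_borel(1) lebesgue_vimage_preserving[OF T_borel(1) T_distr(1)]
      lebesgue_vimage_preserving[OF T_borel(2) T_distr(2)]
    by (metis borel_open sets_completionI_sets sets_lborel)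
qed

end
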